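(* Let $E$ be a finite set, $d\ge1$, $A\in\mathbb T^{d\times E}$, and let $\mu=\pi(A)$ be a valuated matroid of rank $d$ on $E$. Let $x,y\in\mathbb T^d$. Then in the poset of transversal extensions of $\mu$, the elements $\pi(A|x)$ and $\pi(A|y)$ have a unique greatest lower bound, and it equals $\pi(A|\min(x,y))$, where $\min(x,y)$ is the coordinatewise minimum and $(A|z)$ denotes $A$ with $z$ appended as a new column indexed by a new element $*$.
   Context: $\mathbb T=\mathbb R\cup\{\infty\}$ with operations $\min$ and $+$. A valuated matroid of rank $d$ on a finite set $E$ is a function $\mu:\binom Ed\to\mathbb T$ such that $\mu^{-1}(\mathbb R)$ is the set of bases of a matroid and for all $S\in\binom E{d-2}$ and $i,j,k,l\notin S$ the minimum of $\mu_{Sij}+\mu_{Skl},\ \mu_{Sik}+\mu_{Sjl},\ \mu_{Sil}+\mu_{Sjk}$ is attained at least twice; functions differing by a global real constant are identified. The tropical Stiefel map $\pi$ sends $A\in\mathbb T^{d\times E}$ to $B\mapsto\min\{\sum_{i\in B}A_{\phi(i),i}:\phi:B\to[d]\text{ bijection}\}$ on $\binom Ed$. A valuated matroid is transversal if it equals $\pi(A)$ for some $A$ (a matrix presentation). A transversal extension of a transversal valuated matroid $\mu$ of rank $d$ on $E$ is a valuated matroid of the form $\pi(A'|z)$ on $E\sqcup\{*\}$ where $A'$ is any matrix presentation of $\mu$ and $z\in\mathbb T^d$. The poset of transversal extensions of $\mu$ has these as elements, with $\mu'\le\mu''$ iff $\mu'_B\le\mu''_B$ for all $B\in\binom{E\sqcup\{*\}}d$,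 where representatives of $\mu'$ and $\mu''$ are chosen so that $\mu'_B=\mu''_B$ for all $B$ with $*\notin B$. *)

theory Defs
  imports
    "HOL-Analysis.Extended_Real_Limits"
    "HOL-Library.Ramsey"
    "HOL-Algebra.Order"
begin

text \<open>
  The tropical semiring is the set of extended reals other than \<open>-\<infinity>\<close>. Functions on the
  \<open>d\<close>-element subsets of \<open>E\<close> are modelled by total functions of which only the values on
  \<^term>\<open>[E]\<^bsup>d\<^esup>\<close> matter.
\<close>

definition tropical :: "ereal set" where
  "tropical = UNIV - {-\<infinity>}"

definition matroid_bases :: "'a set \<Rightarrow> 'a set set \<Rightarrow> bool" where
  "matroid_bases E Bs \<longleftrightarrow>
     finite E \<and> Bs \<subseteq> Pow E \<and> Bs \<noteq> {} \<and>
     (\<forall>B\<in>Bs. \<forall>B'\<in>Bs. \<forall>i\<in>B - B'. \<exists>j\<in>B' - B. insert j (B - {i}) \<in> Bs)"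

definition min_attained_twice :: "ereal \<Rightarrow> ereal \<Rightarrow> ereal \<Rightarrow> bool" where
  "min_attained_twice a b c \<longleftrightarrow>
     (a = b \<and> a \<le> c) \<or> (a = c \<and> a \<le> b) \<or> (b = c \<and> b \<le> a)"

text \<open>
  The condition \<open>S \<in> [E]\<^bsup>n\<^esup>\<close> with \<open>n + 2 = d\<close> avoids truncated subtraction:
  for \<open>d = 1\<close> there are no three-term relations.
\<close>

definition valuated_matroid :: "'a set \<Rightarrow> nat \<Rightarrow> ('a set \<Rightarrow> ereal) \<Rightarrow> bool" where
  "valuated_matroid E d \<mu> \<longleftrightarrow>
     \<mu> \<in> [E]\<^bsup>d\<^esup> \<rightarrow> tropical \<and>
     matroid_bases E {B \<in> [E]\<^bsup>d\<^esup>. \<mu> B \<in> range ereal} \<and>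
     (\<forall>n S i j k l. n + 2 = d \<longrightarrow> S \<in> [E]\<^bsup>n\<^esup> \<longrightarrow> {i, j, k, l} \<subseteq> E - S \<longrightarrow> distinct [i, j, k, l] \<longrightarrow>
        min_attained_twice
          (\<mu> (S \<union> {i, j}) + \<mu> (S \<union> {k, l}))
          (\<mu> (S \<union> {i, k}) + \<mu> (S \<union> {j, l}))
          (\<mu> (S \<union> {i, l}) + \<mu> (S \<union> {j, k})))"

text \<open>
  The functions identified with \<open>\<mu>\<close>: those which differ from it, on the \<open>d\<close>-subsets of \<open>E\<close>,
  by a global real constant.
\<close>

definition vm_class :: "'a set \<Rightarrow> nat \<Rightarrow> ('a set \<Rightarrow> ereal) \<Rightarrow> ('a set \<Rightarrow> ereal) set" where
  "vm_class E d \<mu> = {\<nu>. \<exists>c::real. \<forall>B\<in>[E]\<^bsup>d\<^esup>. \<nu> B = \<mu> B + ereal c}"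

text \<open>
  A matrix with rows indexed by \<open>{1..d}\<close> and columns indexed by \<open>E\<close> is an element of
  \<open>{1..d} \<rightarrow> E \<rightarrow> tropical\<close>. The set under \<^const>\<open>Min\<close> is finite, and nonempty
  whenever \<open>B\<close> has \<open>d\<close> elements.
\<close>

definition stiefel :: "nat \<Rightarrow> (nat \<Rightarrow> 'a \<Rightarrow> ereal) \<Rightarrow> 'a set \<Rightarrow> ereal" where
  "stiefel d A B = Min {\<Sum>i\<in>B. A (\<phi> i) i |\<phi>. bij_betw \<phi> B {1..d}}"

definition append_col ::
    "(nat \<Rightarrow> 'a \<Rightarrow> ereal) \<Rightarrow> 'a \<Rightarrow> (nat \<Rightarrow> ereal) \<Rightarrow> nat \<Rightarrow> 'a \<Rightarrow> ereal" where
  "append_col A star z = (\<lambda>r. (A r)(star := z r))"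

text \<open>
  The equality of \<open>\<mu>\<close> and the Stiefel image of \<open>A\<close> is equality as valuated matroids, that is,
  up to a global constant.
\<close>

definition matrix_presentation ::
    "'a set \<Rightarrow> nat \<Rightarrow> ('a set \<Rightarrow> ereal) \<Rightarrow> (nat \<Rightarrow> 'a \<Rightarrow> ereal) \<Rightarrow> bool" where
  "matrix_presentation E d \<mu> A \<longleftrightarrow>
     A \<in> {1..d} \<rightarrow> E \<rightarrow> tropical \<and> vm_class E d (stiefel d A) = vm_class E d \<mu>"

definition transversal_extension ::
    "'a set \<Rightarrow> nat \<Rightarrow> 'a \<Rightarrow> ('a set \<Rightarrow> ereal) \<Rightarrow> ('a set \<Rightarrow> ereal) \<Rightarrow> bool" where
  "transversal_extension E d star \<mu> \<nu> \<longleftrightarrow>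
     valuated_matroid (insert star E) d \<nu> \<and>
     (\<exists>A' z. matrix_presentation E d \<mu> A' \<and> z \<in> {1..d} \<rightarrow> tropical \<and>
        vm_class (insert star E) d \<nu> =
        vm_class (insert star E) d (stiefel d (append_col A' star z)))"

text \<open>
  The elements of the poset are classes of functions modulo global constants. The new
  element \<open>star\<close> is to be outside \<open>E\<close>, so that \<^term>\<open>[E]\<^bsup>d\<^esup>\<close> consists of the \<open>d\<close>-subsets of
  \<^term>\<open>insert star E\<close> avoiding \<open>star\<close>.
\<close>

definition transversal_extensions ::
    "'a set \<Rightarrow> nat \<Rightarrow> 'a \<Rightarrow> ('a set \<Rightarrow> ereal) \<Rightarrow> ('a set \<Rightarrow> ereal) set gorder" where
  "transversal_extensions E d star \<mu> =
     \<lparr>carrier = vm_class (insert star E) d ` {\<nu>. transversal_extension E d star \<mu> \<nu>},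
      eq = (=),
      le = (\<lambda>P Q. \<exists>\<mu>'\<in>P. \<exists>\<mu>''\<in>Q.
              (\<forall>B\<in>[E]\<^bsup>d\<^esup>. \<mu>' B = \<mu>'' B) \<and> (\<forall>B\<in>[insert star E]\<^bsup>d\<^esup>. \<mu>' B \<le> \<mu>'' B))\<rparr>"

lemma vm_class_refl: "\<mu> \<in> vm_class E d \<mu>"
  by (auto simp: vm_class_def intro: exI[of _ 0])

lemma vm_class_eq:
  assumes "\<nu> \<in> vm_class E d \<mu>"
  shows "vm_class E d \<nu> = vm_class E d \<mu>"
proof -
  obtain c :: real where c: "\<forall>B\<in>[E]\<^bsup>d\<^esup>. \<nu> B = \<mu> B + ereal c"
    using assms by (auto simp: vm_class_def)
  have "\<exists>b::real. \<forall>B\<in>[E]\<^bsup>d\<^esup>. \<kappa> B = \<mu> B + ereal b"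
    if "\<forall>B\<in>[E]\<^bsup>d\<^esup>. \<kappa> B = \<nu> B + ereal a" for \<kappa> and a :: real
    using that c by (intro exI[of _ "c + a"]) (auto simp: add.assoc)
  moreover have "\<exists>b::real. \<forall>B\<in>[E]\<^bsup>d\<^esup>. \<kappa> B = \<nu> B + ereal b"
    if "\<forall>B\<in>[E]\<^bsup>d\<^esup>. \<kappa> B = \<mu> B + ereal a" for \<kappa> and a :: real
    using that c by (intro exI[of _ "a - c"]) (auto simp: add.assoc)
  ultimately show ?thesis
    unfolding vm_class_def by blast
qed

lemma stiefel_append_col:
  assumes "star \<notin> E" "B \<in> [E]\<^bsup>d\<^esup>"
  shows "stiefel d (append_col A star z) B = stiefel d A B"
proof -
  have "(\<Sum>i\<in>B. append_col A star z (\<phi> i) i) = (\<Sum>i\<in>B. A (\<phi> i) i)" for \<phi>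
    using assms by (intro sum.cong) (auto simp: append_col_def nsets_def)
  then show ?thesis
    by (simp add: stiefel_def)
qed

lemma transversal_extensions_representative:
  assumes "star \<notin> E" "P \<in> carrier (transversal_extensions E d star \<mu>)"
  obtains \<nu> where "P = vm_class (insert star E) d \<nu>" "\<forall>B\<in>[E]\<^bsup>d\<^esup>. \<nu> B = \<mu> B"
proof -
  obtain A' z where A': "matrix_presentation E d \<mu> A'"
    and P: "P = vm_class (insert star E) d (stiefel d (append_col A' star z))"
    using assms(2) by (auto simp: transversal_extensions_def transversal_extension_def)
  have "\<mu> \<in> vm_class E d (stiefel d A')"
    using A' vm_class_refl by (auto simp: matrix_presentation_def)
  then obtain c :: real where c: "\<forall>B\<in>[E]\<^bsup>d\<^esup>. \<mu> B = stiefel d A' B + ereal c"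
    by (auto simp: vm_class_def)
  define \<nu> where "\<nu> = (\<lambda>B. stiefel d (append_col A' star z) B + ereal c)"
  have "\<nu> \<in> vm_class (insert star E) d (stiefel d (append_col A' star z))"
    by (auto simp: \<nu>_def vm_class_def)
  then have "P = vm_class (insert star E) d \<nu>"
    using P vm_class_eq by metis
  moreover have "\<forall>B\<in>[E]\<^bsup>d\<^esup>. \<nu> B = \<mu> B"
    using c assms(1) by (simp add: \<nu>_def stiefel_append_col)
  ultimately show ?thesis
    using that by blast
qed

lemma transversal_extensions_le_iff:
  assumes "valuated_matroid E d \<mu>"
    and "\<forall>B\<in>[E]\<^bsup>d\<^esup>. \<nu> B = \<mu> B" "\<forall>B\<in>[E]\<^bsup>d\<^esup>. \<kappa> B = \<mu> B"
  shows "vm_class (insert star E) d \<nu> \<sqsubseteq>\<^bsub>transversal_extensions E d star \<mu>\<^esub> vm_class (insert star E) d \<kappa>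
    \<longleftrightarrow> (\<forall>B\<in>[insert star E]\<^bsup>d\<^esup>. \<nu> B \<le> \<kappa> B)" (is "?L \<longleftrightarrow> ?R")
proof
  assume ?L
  then obtain \<nu>' \<kappa>' where in_class:
      "\<nu>' \<in> vm_class (insert star E) d \<nu>" "\<kappa>' \<in> vm_class (insert star E) d \<kappa>"
    and eq: "\<forall>B\<in>[E]\<^bsup>d\<^esup>. \<nu>' B = \<kappa>' B" and le: "\<forall>B\<in>[insert star E]\<^bsup>d\<^esup>. \<nu>' B \<le> \<kappa>' B"
    by (auto simp: transversal_extensions_def)
  obtain a b :: real where a: "\<forall>B\<in>[insert star E]\<^bsup>d\<^esup>. \<nu>' B = \<nu> B + ereal a"
    and b: "\<forall>B\<in>[insert star E]\<^bsup>d\<^esup>. \<kappa>' B = \<kappa> B + ereal b"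
    using in_class by (auto simp: vm_class_def)
  have "{B \<in> [E]\<^bsup>d\<^esup>. \<mu> B \<in> range ereal} \<noteq> {}"
    using assms(1) unfolding valuated_matroid_def matroid_bases_def by (elim conjE)
  then obtain B r where B: "B \<in> [E]\<^bsup>d\<^esup>" "\<mu> B = ereal r"
    by blast
  then have B': "B \<in> [insert star E]\<^bsup>d\<^esup>"
    by (auto simp: nsets_def)
  have "ereal r + ereal a = ereal r + ereal b"
    using bspec[OF a B'] bspec[OF b B'] bspec[OF eq B(1)] bspec[OF assms(2) B(1)]
      bspec[OF assms(3) B(1)] B(2) by simp
  then have "a = b"
    by simp
  show ?R
  proof
    fix C assume "C \<in> [insert star E]\<^bsup>d\<^esup>"
    then have "\<nu> C + ereal a \<le> \<kappa> C + ereal a"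
      using a b le \<open>a = b\<close> by metis
    then show "\<nu> C \<le> \<kappa> C"
      by (cases "\<nu> C"; cases "\<kappa> C") auto
  qed
next
  assume ?R
  moreover have "\<forall>B\<in>[E]\<^bsup>d\<^esup>. \<nu> B = \<kappa> B"
    using assms(2,3) by simp
  ultimately show ?L
    by (auto simp: transversal_extensions_def
        intro!: bexI[OF _ vm_class_refl[of \<nu>]] bexI[OF _ vm_class_refl[of \<kappa>]])
qed

lemma partial_order_transversal_extensions:
  assumes "valuated_matroid E d \<mu>" "star \<notin> E"
  shows "partial_order (transversal_extensions E d star \<mu>)"
proof -
  let ?L = "transversal_extensions E d star \<mu>"
  note rep = transversal_extensions_representative[OF assms(2)]
  note le_iff = transversal_extensions_le_iff[OF assms(1)]
  have eq: "(.=\<^bsub>?L\<^esub>) = (=)"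
    by (simp add: transversal_extensions_def)
  have refl: "P \<sqsubseteq>\<^bsub>?L\<^esub> P" if P: "P \<in> carrier ?L" for P
  proof -
    obtain \<nu> where "P = vm_class (insert star E) d \<nu>" "\<forall>B\<in>[E]\<^bsup>d\<^esup>. \<nu> B = \<mu> B"
      using rep[OF P] by blast
    then show ?thesis
      by (simp add: le_iff)
  qed
  have antisym: "P = Q" if PQ: "P \<in> carrier ?L" "Q \<in> carrier ?L" "P \<sqsubseteq>\<^bsub>?L\<^esub> Q" "Q \<sqsubseteq>\<^bsub>?L\<^esub> P" for P Q
  proof -
    obtain \<nu> \<kappa> where reps: "P = vm_class (insert star E) d \<nu>" "\<forall>B\<in>[E]\<^bsup>d\<^esup>. \<nu> B = \<mu> B"
        "Q = vm_class (insert star E) d \<kappa>" "\<forall>B\<in>[E]\<^bsup>d\<^esup>. \<kappa> B = \<mu> B"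
      using rep[OF PQ(1)] rep[OF PQ(2)] by metis
    then have "\<forall>B\<in>[insert star E]\<^bsup>d\<^esup>. \<nu> B = \<kappa> B"
      using PQ(3,4) by (simp add: le_iff order_antisym)
    then show ?thesis
      using reps by (simp add: vm_class_def)
  qed
  have trans: "P \<sqsubseteq>\<^bsub>?L\<^esub> R" if PQR: "P \<in> carrier ?L" "Q \<in> carrier ?L" "R \<in> carrier ?L"
      "P \<sqsubseteq>\<^bsub>?L\<^esub> Q" "Q \<sqsubseteq>\<^bsub>?L\<^esub> R" for P Q R
  proof -
    obtain \<nu> \<kappa> \<rho> where reps: "P = vm_class (insert star E) d \<nu>" "\<forall>B\<in>[E]\<^bsup>d\<^esup>. \<nu> B = \<mu> B"
        "Q = vm_class (insert star E) d \<kappa>" "\<forall>B\<in>[E]\<^bsup>d\<^esup>. \<kappa> B = \<mu> B"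
        "R = vm_class (insert star E) d \<rho>" "\<forall>B\<in>[E]\<^bsup>d\<^esup>. \<rho> B = \<mu> B"
      using rep[OF PQR(1)] rep[OF PQR(2)] rep[OF PQR(3)] by metis
    then show ?thesis
      using PQR(4,5) by (simp add: le_iff) (meson order_trans)
  qed
  show ?thesis
    by unfold_locales (unfold eq, (metis refl antisym trans)+)
qed

end

theory Submission
  imports Defs
begin

text \<open>
  For a fixed bijection \<open>\<phi>\<close>, replacing the last column \<open>z\<close> by \<open>min x y\<close> replaces the weight of
  \<open>\<phi>\<close> by the minimum of its two weights. Hence \<open>\<pi>(A|min x y)\<close> is the pointwise minimum of
  \<open>\<pi>(A|x)\<close> and \<open>\<pi>(A|y)\<close>, and a pointwise minimum that lies in the poset is the greatest lower
  bound. That it does lie in the poset follows from the valuated exchange property of \<open>\<pi>(A)\<close>: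
  given optimal matchings of \<open>B\<close> and \<open>B'\<close> and \<open>i \<in> B - B'\<close>, follow the alternating path from
  \<open>i\<close> to its other end \<open>j \<in> B' - B\<close> and swap the two matchings along it; the total weight is
  unchanged.
\<close>

section \<open>Tropical minors as minima over matchings\<close>

lemma stiefel_weights_finite:
  fixes d :: nat
  assumes "finite B"
  shows "finite {\<Sum>i\<in>B. A (\<phi> i) i |\<phi>. bij_betw \<phi> B {1..d}}"
proof (rule finite_subset)
  show "{\<Sum>i\<in>B. A (\<phi> i) i |\<phi>. bij_betw \<phi> B {1..d}}
      \<subseteq> (\<lambda>\<phi>. \<Sum>i\<in>B. A (\<phi> i) i) ` (B \<rightarrow>\<^sub>E {1..d})"
  proof clarify
    \<comment> \<open>The \<open>\<phi>\<close> are total functions, arbitrary outside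
      \<open>B\<close>, so there may be infinitely many; the weight only sees their restriction to
      \<open>B\<close>.\<close>
    fix \<phi> assume "bij_betw \<phi> B {1..d}"
    then have "restrict \<phi> B \<in> B \<rightarrow>\<^sub>E {1..d}"
      by (auto dest: bij_betwE)
    moreover have "(\<Sum>i\<in>B. A (\<phi> i) i) = (\<Sum>i\<in>B. A (restrict \<phi> B i) i)"
      by (intro sum.cong) auto
    ultimately show "(\<Sum>i\<in>B. A (\<phi> i) i) \<in> (\<lambda>\<phi>. \<Sum>i\<in>B. A (\<phi> i) i) ` (B \<rightarrow>\<^sub>E {1..d})"
      by blast
  qed
  show "finite ((\<lambda>\<phi>. \<Sum>i\<in>B. A (\<phi> i) i) ` (B \<rightarrow>\<^sub>E {1..d}))"
    using assms by (intro finite_imageI finite_PiE finite_atLeastAtMost)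
qed

lemma stiefel_weights_nonempty:
  fixes d :: nat
  assumes "finite B" "card B = d"
  shows "{\<Sum>i\<in>B. A (\<phi> i) i |\<phi>. bij_betw \<phi> B {1..d}} \<noteq> {}"
  using finite_same_card_bij[of B "{1..d}"] assms by auto

lemma stiefel_le:
  assumes "finite B" "bij_betw \<phi> B {1..d}"
  shows "stiefel d A B \<le> (\<Sum>i\<in>B. A (\<phi> i) i)"
  unfolding stiefel_def using assms by (intro Min_le stiefel_weights_finite) auto

lemma stiefel_attained:
  assumes "finite B" "card B = d"
  obtains \<phi> where "bij_betw \<phi> B {1..d}" "stiefel d A B = (\<Sum>i\<in>B. A (\<phi> i) i)"
  using Min_in[OF stiefel_weights_finite[OF assms(1), of A d] stiefel_weights_nonempty[OF assms, of A]]
  unfolding stiefel_def by auto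

text \<open>The infimum form keeps the index set of bijections fixed while the weights vary, which
  is what \<open>INF_inf_distrib\<close> asks for.\<close>

lemma stiefel_eq_INF:
  assumes "finite B" "card B = d"
  shows "stiefel d A B = (INF \<phi>\<in>{\<phi>. bij_betw \<phi> B {1..d}}. \<Sum>i\<in>B. A (\<phi> i) i)"
proof -
  have "{\<Sum>i\<in>B. A (\<phi> i) i |\<phi>. bij_betw \<phi> B {1..d}}
      = (\<lambda>\<phi>. \<Sum>i\<in>B. A (\<phi> i) i) ` {\<phi>. bij_betw \<phi> B {1..d}}"
    by auto
  then show ?thesis
    unfolding stiefel_def
    using Min_Inf[OF stiefel_weights_finite[OF assms(1), of A d] stiefel_weights_nonempty[OF assms, of A]]
    by simp
qed

text \<open>Adding \<open>c\<close> is monotone on the linear order \<open>ereal\<close>, also for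
  infinite \<open>c\<close>, and monotone maps preserve binary minima.\<close>

lemma ereal_min_add: "min a b + c = min (a + c) (b + c)" for a b c :: ereal
  by (rule min_of_mono[of "\<lambda>t. t + c", symmetric]) (simp add: monoI add_right_mono)

lemma stiefel_append_col_min:
  assumes "finite B" "card B = d"
  shows "stiefel d (append_col A star (\<lambda>r. min (x r) (y r))) B
    = min (stiefel d (append_col A star x) B) (stiefel d (append_col A star y) B)"
proof -
  define w where "w z \<phi> = (\<Sum>i\<in>B. append_col A star z (\<phi> i) i)" for z \<phi>
  have w_min: "w (\<lambda>r. min (x r) (y r)) \<phi> = inf (w x \<phi>) (w y \<phi>)" for \<phi>
  proof (cases "star \<in> B")
    case True
    \<comment> \<open>The column \<open>star\<close> contributes a single summand, so
      \<open>z\<close> enters each weight exactly once.\<close>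
    have "w z \<phi> = z (\<phi> star) + (\<Sum>i\<in>B - {star}. A (\<phi> i) i)" for z
      unfolding w_def using assms(1) True
      by (simp add: sum.remove append_col_def)
    then show ?thesis
      by (simp add: inf_min ereal_min_add)
  next
    case False
    have "w z \<phi> = (\<Sum>i\<in>B. A (\<phi> i) i)" for z
      unfolding w_def using False by (intro sum.cong) (auto simp: append_col_def)
    then show ?thesis
      by simp
  qed
  have w: "stiefel d (append_col A star z) B = (INF \<phi>\<in>{\<phi>. bij_betw \<phi> B {1..d}}. w z \<phi>)" for z
    unfolding w_def using assms by (rule stiefel_eq_INF)
  show ?thesis
    using INF_inf_distrib[of "w x" "{\<phi>. bij_betw \<phi> B {1..d}}" "w y", symmetric]
    unfolding w w_min inf_min .
qed

section \<open>Valuated exchange along alternating paths\<close>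

text \<open>
  For \<open>\<sigma> = \<psi>\<inverse> \<circ> \<phi>\<close> the set \<open>P\<close> is the part in \<open>B\<close> of the alternating path from \<open>i\<close>. It is the least
  set containing \<open>i\<close> and closed under \<open>\<sigma>\<close> as long as \<open>\<sigma>\<close> stays in \<open>B\<close>; counting shows that
  exactly one element of \<open>\<sigma> ` P\<close> lies outside \<open>B\<close>.
\<close>

lemma alternating_path:
  assumes "finite B" "bij_betw \<sigma> B B'" "i \<in> B - B'"
  obtains P j where "P \<subseteq> B" "i \<in> P" "j \<in> B' - B" "\<sigma> ` P = insert j (P - {i})"
proof -
  define closed where "closed X \<longleftrightarrow> X \<subseteq> B \<and> i \<in> X \<and> \<sigma> ` X \<inter> B \<subseteq> X" for X
  define P where "P = \<Inter> {X. closed X}"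
  have "closed B"
    using assms(3) by (auto simp: closed_def)
  then have P: "P \<subseteq> B" "i \<in> P" "\<sigma> ` P \<inter> B \<subseteq> P"
    unfolding P_def closed_def by blast+
  have sub: "\<sigma> ` P \<subseteq> B'"
    using P(1) assms(2) by (auto simp: bij_betw_def)
  then have "i \<notin> \<sigma> ` P"
    using assms(3) by blast
  \<comment> \<open>Leastness of \<open>P\<close> enters here: dropping all elements other than
    \<open>i\<close> that are not \<open>\<sigma>\<close>-images of elements of \<open>P\<close>
    leaves a closed set, so nothing was dropped.\<close>
  have "closed (insert i (\<sigma> ` P \<inter> B))"
    using P assms(3) unfolding closed_def by blast
  then have "P \<subseteq> insert i (\<sigma> ` P \<inter> B)"
    unfolding P_def by blast
  then have eq: "\<sigma> ` P \<inter> B = P - {i}"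
    using P(3) \<open>i \<notin> \<sigma> ` P\<close> by auto
  have fin: "finite P"
    using P(1) assms(1) finite_subset by blast
  have "card (\<sigma> ` P) = card P"
    using P(1) assms(2) by (intro card_image) (auto simp: bij_betw_def intro: inj_on_subset)
  moreover have "card (\<sigma> ` P) = card (\<sigma> ` P \<inter> B) + card (\<sigma> ` P - B)"
    using fin by (metis card_Int_Diff finite_imageI)
  moreover have "card P = Suc (card (P - {i}))"
    using fin P(2) by (metis card.remove)
  ultimately have "card (\<sigma> ` P - B) = 1"
    using eq by simp
  then obtain j where j: "\<sigma> ` P - B = {j}"
    by (auto simp: card_1_singleton_iff)
  have "j \<in> B' - B" "\<sigma> ` P = insert j (P - {i})"
    using j sub eq by blast+
  then show ?thesis
    using that P by blast
qed

text \<open>Matchings of disjoint column sets onto complementary row sets glue to a matching of the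
  union, and its weight bounds the minimum from above.\<close>

lemma stiefel_swap:
  assumes "finite X" "X = U \<union> V" "U \<inter> V = {}"
    and "bij_betw \<phi> U R" "bij_betw \<psi> V S" "R \<union> S = {1..d}" "R \<inter> S = {}"
  shows "stiefel d A X \<le> (\<Sum>e\<in>U. A (\<phi> e) e) + (\<Sum>e\<in>V. A (\<psi> e) e)"
proof -
  let ?\<chi> = "\<lambda>e. if e \<in> U then \<phi> e else \<psi> e"
  have "bij_betw ?\<chi> U R"
    using assms(4) by (rule bij_betw_cong[THEN iffD1, rotated]) simp
  moreover have "bij_betw ?\<chi> V S"
    using assms(5) by (rule bij_betw_cong[THEN iffD1, rotated]) (use assms(3) in auto)
  ultimately have "bij_betw ?\<chi> (U \<union> V) (R \<union> S)"
    using assms(7) by (rule bij_betw_combine)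
  then have "bij_betw ?\<chi> X {1..d}"
    unfolding assms(2,6) .
  then have "stiefel d A X \<le> (\<Sum>e\<in>X. A (?\<chi> e) e)"
    by (rule stiefel_le[OF assms(1)])
  also have "\<dots> = (\<Sum>e\<in>U. A (?\<chi> e) e) + (\<Sum>e\<in>V. A (?\<chi> e) e)"
    unfolding assms(2) using assms(1-3) by (intro sum.union_disjoint) auto
  also have "(\<Sum>e\<in>U. A (?\<chi> e) e) = (\<Sum>e\<in>U. A (\<phi> e) e)"
    by simp
  also have "(\<Sum>e\<in>V. A (?\<chi> e) e) = (\<Sum>e\<in>V. A (\<psi> e) e)"
    using assms(3) by (intro sum.cong) auto
  finally show ?thesis .
qed

text \<open>The common source of the basis exchange axiom and the three-term relations. Partial
  weights are only regrouped, never cancelled, so infinite entries do no harm.\<close>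

lemma stiefel_exchange:
  assumes fin: "finite B" "finite B'" and card: "card B = d" "card B' = d" and i: "i \<in> B - B'"
  obtains j where "j \<in> B' - B"
    "stiefel d A (insert j (B - {i})) + stiefel d A (insert i (B' - {j}))
      \<le> stiefel d A B + stiefel d A B'"
proof -
  obtain \<phi> where \<phi>: "bij_betw \<phi> B {1..d}" "stiefel d A B = (\<Sum>e\<in>B. A (\<phi> e) e)"
    using stiefel_attained fin(1) card(1) by blast
  obtain \<psi> where \<psi>: "bij_betw \<psi> B' {1..d}" "stiefel d A B' = (\<Sum>e\<in>B'. A (\<psi> e) e)"
    using stiefel_attained fin(2) card(2) by blast
  \<comment> \<open>\<open>\<sigma>\<close> sends a column of \<open>B\<close> to the column of
    \<open>B'\<close> matched to the same row; its orbits are alternating paths.\<close>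
  define \<sigma> where "\<sigma> = the_inv_into B' \<psi> \<circ> \<phi>"
  have "bij_betw \<sigma> B B'"
    unfolding \<sigma>_def using \<phi>(1) \<psi>(1) by (metis bij_betw_the_inv_into bij_betw_trans)
  then obtain P j where P: "P \<subseteq> B" "i \<in> P" and j: "j \<in> B' - B"
    and \<sigma>P: "\<sigma> ` P = insert j (P - {i})"
    using alternating_path fin(1) i by metis
  let ?Q = "\<sigma> ` P"
  have Q: "?Q \<subseteq> B'"
    using \<open>bij_betw \<sigma> B B'\<close> P(1) by (auto simp: bij_betw_def)
  \<comment> \<open>Hence \<open>P\<close> under \<open>\<phi>\<close> and \<open>?Q\<close> under
    \<open>\<psi>\<close> cover the same rows and can trade places.\<close>
  have "\<psi> (\<sigma> e) = \<phi> e" if "e \<in> B" for e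
    unfolding \<sigma>_def o_def using that \<phi>(1) \<psi>(1)
    by (metis bij_betwE bij_betw_def f_the_inv_into_f)
  then have img: "\<psi> ` ?Q = \<phi> ` P"
    using P(1) by (force simp: image_image)
  have bij\<phi>: "bij_betw \<phi> P (\<phi> ` P)"
    using \<phi>(1) P(1) by (rule bij_betw_subset) simp
  have bij\<psi>: "bij_betw \<psi> ?Q (\<phi> ` P)"
    using \<psi>(1) Q img by (rule bij_betw_subset)
  have PR: "\<phi> ` P \<subseteq> {1..d}"
    using \<phi>(1) P(1) by (auto simp: bij_betw_def)
  have bij\<phi>': "bij_betw \<phi> (B - P) ({1..d} - \<phi> ` P)"
    using \<phi>(1) bij\<phi> P(1) PR by (rule bij_betw_DiffI)
  have bij\<psi>': "bij_betw \<psi> (B' - ?Q) ({1..d} - \<phi> ` P)"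
    using \<psi>(1) bij\<psi> Q PR by (rule bij_betw_DiffI)
  let ?b = "\<Sum>e\<in>B - P. A (\<phi> e) e" and ?p = "\<Sum>e\<in>P. A (\<phi> e) e"
    and ?b' = "\<Sum>e\<in>B' - ?Q. A (\<psi> e) e" and ?q = "\<Sum>e\<in>?Q. A (\<psi> e) e"
  \<comment> \<open>Since \<open>?Q\<close> is \<open>P\<close> with \<open>i\<close> replaced by
    \<open>j\<close>, the trade exchanges only these two elements. The new matchings need not be
    optimal, hence only an inequality.\<close>
  have "stiefel d A (insert j (B - {i})) \<le> ?b + ?q"
    using P j PR fin(1) by (intro stiefel_swap[OF _ _ _ bij\<phi>' bij\<psi>]) (auto simp: \<sigma>P)
  moreover have "stiefel d A (insert i (B' - {j})) \<le> ?b' + ?p"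
    using P Q i j PR fin(2) by (intro stiefel_swap[OF _ _ _ bij\<psi>' bij\<phi>]) (auto simp: \<sigma>P)
  ultimately have "stiefel d A (insert j (B - {i})) + stiefel d A (insert i (B' - {j}))
      \<le> (?b + ?q) + (?b' + ?p)"
    by (rule add_mono)
  also have "\<dots> = (?b + ?p) + (?b' + ?q)"
    by (simp only: ac_simps)
  also have "?b + ?p = stiefel d A B"
    unfolding \<phi>(2) using P(1) fin(1) by (rule sum.subset_diff[symmetric])
  also have "?b' + ?q = stiefel d A B'"
    unfolding \<psi>(2) using Q fin(2) by (rule sum.subset_diff[symmetric])
  finally have "stiefel d A (insert j (B - {i})) + stiefel d A (insert i (B' - {j}))
      \<le> stiefel d A B + stiefel d A B'" .
  then show ?thesis
    using that j by blast
qed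

section \<open>Valuated matroid axioms for a Stiefel image\<close>

lemma stiefel_tropical:
  assumes "A \<in> {1..d} \<rightarrow> E \<rightarrow> tropical" "B \<in> [E]\<^bsup>d\<^esup>"
  shows "stiefel d A B \<in> tropical"
proof -
  have B: "B \<subseteq> E" "finite B" "card B = d"
    using assms(2) by (auto simp: nsets_def)
  obtain \<phi> where \<phi>: "bij_betw \<phi> B {1..d}" "stiefel d A B = (\<Sum>i\<in>B. A (\<phi> i) i)"
    using stiefel_attained B(2,3) by blast
  have "A (\<phi> i) i \<noteq> -\<infinity>" if "i \<in> B" for i
    using assms(1) B(1) bij_betwE[OF \<phi>(1)] that by (fastforce simp: tropical_def)
  with B(2) have "(\<Sum>i\<in>B. A (\<phi> i) i) \<noteq> -\<infinity>"
    by (induction B rule: finite_induct) auto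
  then show ?thesis
    unfolding \<phi>(2) tropical_def by simp
qed

text \<open>Exchanging \<open>j\<close> out of \<open>S \<union> {i, j}\<close> against
  \<open>S \<union> {k, l}\<close> can only bring in \<open>k\<close> or \<open>l\<close>, and each
  choice produces one of the other two pairings.\<close>

lemma stiefel_three_term:
  assumes "n + 2 = d" "S \<in> [E]\<^bsup>n\<^esup>" "{i, j, k, l} \<subseteq> E - S" "distinct [i, j, k, l]"
  shows "stiefel d A (S \<union> {i, k}) + stiefel d A (S \<union> {j, l})
        \<le> stiefel d A (S \<union> {i, j}) + stiefel d A (S \<union> {k, l}) \<or>
      stiefel d A (S \<union> {i, l}) + stiefel d A (S \<union> {j, k})
        \<le> stiefel d A (S \<union> {i, j}) + stiefel d A (S \<union> {k, l})"
proof -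
  have S: "finite S" "card S = n" "i \<notin> S" "j \<notin> S" "k \<notin> S" "l \<notin> S"
    using assms(2,3) by (auto simp: nsets_def)
  let ?B = "S \<union> {i, j}" and ?B' = "S \<union> {k, l}"
  have "card ?B = d" "card ?B' = d"
    using S assms(1,4) by auto
  then obtain h where h: "h \<in> ?B' - ?B"
    "stiefel d A (insert h (?B - {j})) + stiefel d A (insert j (?B' - {h}))
      \<le> stiefel d A ?B + stiefel d A ?B'"
    using stiefel_exchange[of ?B ?B' d j A] S assms(4) by auto
  then consider "h = k" | "h = l"
    by blast
  then show ?thesis
  proof cases
    case 1
    then have "insert h (?B - {j}) = S \<union> {i, k}" "insert j (?B' - {h}) = S \<union> {j, l}"
      using S assms(4) by auto
    then show ?thesis
      using h(2) by simp
  next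
    case 2
    then have "insert h (?B - {j}) = S \<union> {i, l}" "insert j (?B' - {h}) = S \<union> {j, k}"
      using S assms(4) by auto
    then show ?thesis
      using h(2) by simp
  qed
qed

text \<open>For two bases the right side of the exchange inequality is finite, which forces the
  exchanged set to be a basis. \<open>B\<^sub>0\<close> ensures that a basis exists.\<close>

lemma matroid_bases_stiefel:
  assumes "finite E" "A \<in> {1..d} \<rightarrow> E \<rightarrow> tropical"
    and "B\<^sub>0 \<in> [E]\<^bsup>d\<^esup>" "stiefel d A B\<^sub>0 \<noteq> \<infinity>"
  shows "matroid_bases E {B \<in> [E]\<^bsup>d\<^esup>. stiefel d A B \<in> range ereal}"
proof -
  have real_iff: "stiefel d A B \<in> range ereal \<longleftrightarrow> stiefel d A B \<noteq> \<infinity>" if "B \<in> [E]\<^bsup>d\<^esup>" for B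
    using stiefel_tropical[OF assms(2) that] by (cases "stiefel d A B") (auto simp: tropical_def)
  have "\<exists>j\<in>B' - B. insert j (B - {i}) \<in> {B \<in> [E]\<^bsup>d\<^esup>. stiefel d A B \<in> range ereal}"
    if B: "B \<in> [E]\<^bsup>d\<^esup>" "stiefel d A B \<in> range ereal"
      and B': "B' \<in> [E]\<^bsup>d\<^esup>" "stiefel d A B' \<in> range ereal" and i: "i \<in> B - B'"
    for B B' i
  proof -
    have fin: "finite B" "finite B'" "card B = d" "card B' = d" "B \<subseteq> E" "B' \<subseteq> E"
      using B(1) B'(1) by (auto simp: nsets_def)
    obtain j where j: "j \<in> B' - B" and le:
      "stiefel d A (insert j (B - {i})) + stiefel d A (insert i (B' - {j}))
        \<le> stiefel d A B + stiefel d A B'"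
      using stiefel_exchange fin(1-4) i by metis
    \<comment> \<open>With \<open>d\<close> positive, the truncated subtraction in the cardinality
      of \<open>B - {i}\<close> is exact.\<close>
    have "d > 0"
      using i fin by (auto simp: card_gt_0_iff)
    then have sets: "insert j (B - {i}) \<in> [E]\<^bsup>d\<^esup>" "insert i (B' - {j}) \<in> [E]\<^bsup>d\<^esup>"
      using fin i j by (auto simp: nsets_def card_Diff_singleton)
    have "stiefel d A (insert i (B' - {j})) \<noteq> -\<infinity>"
      using stiefel_tropical[OF assms(2) sets(2)] by (simp add: tropical_def)
    moreover have "stiefel d A B + stiefel d A B' \<noteq> \<infinity>"
      using B(2) B'(2) by auto
    ultimately have "stiefel d A (insert j (B - {i})) \<noteq> \<infinity>"
      using le by auto
    then show ?thesis
      using j sets(1) real_iff by blast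
  qed
  moreover have "B\<^sub>0 \<in> {B \<in> [E]\<^bsup>d\<^esup>. stiefel d A B \<in> range ereal}"
    using assms(3,4) real_iff by blast
  ultimately show ?thesis
    unfolding matroid_bases_def using assms(1) by (auto simp: nsets_def)
qed

theorem valuated_matroid_stiefel:
  assumes "finite E" "A \<in> {1..d} \<rightarrow> E \<rightarrow> tropical"
    and "B\<^sub>0 \<in> [E]\<^bsup>d\<^esup>" "stiefel d A B\<^sub>0 \<noteq> \<infinity>"
  shows "valuated_matroid E d (stiefel d A)"
  unfolding valuated_matroid_def
proof (intro conjI allI impI)
  show "stiefel d A \<in> [E]\<^bsup>d\<^esup> \<rightarrow> tropical"
    using stiefel_tropical[OF assms(2)] by blast
  show "matroid_bases E {B \<in> [E]\<^bsup>d\<^esup>. stiefel d A B \<in> range ereal}"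
    using matroid_bases_stiefel assms .
  fix n S i j k l
  assume S: "n + 2 = d" "S \<in> [E]\<^bsup>n\<^esup>" and "{i, j, k, l} \<subseteq> E - S" "distinct [i, j, k, l]"
  \<comment> \<open>With each pairing distinguished in turn, every one of the three sums is at least
    one of the other two, so the least value occurs twice.\<close>
  then show "min_attained_twice
      (stiefel d A (S \<union> {i, j}) + stiefel d A (S \<union> {k, l}))
      (stiefel d A (S \<union> {i, k}) + stiefel d A (S \<union> {j, l}))
      (stiefel d A (S \<union> {i, l}) + stiefel d A (S \<union> {j, k}))"
    using stiefel_three_term[OF S, of i j k l A] stiefel_three_term[OF S, of i k j l A]
      stiefel_three_term[OF S, of i l j k A]
    unfolding min_attained_twice_def
    by (auto simp: insert_commute add.commute)
qed

section \<open>Greatest lower bounds in the poset of extensions\<close>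

theorem theorem4p8:
  fixes E :: "'a set" and d :: nat and star :: 'a
    and \<mu> :: "'a set \<Rightarrow> ereal" and A :: "nat \<Rightarrow> 'a \<Rightarrow> ereal" and x y :: "nat \<Rightarrow> ereal"
  defines "L \<equiv> transversal_extensions E d star \<mu>"
    and "ext \<equiv> \<lambda>z. vm_class (insert star E) d (stiefel d (append_col A star z))"
  assumes "finite E" and "d \<ge> 1" and "star \<notin> E"
    and "A \<in> {1..d} \<rightarrow> E \<rightarrow> tropical"
    and "valuated_matroid E d \<mu>"
    and "matrix_presentation E d \<mu> A"
    and "x \<in> {1..d} \<rightarrow> tropical" and "y \<in> {1..d} \<rightarrow> tropical"
  shows "ext x \<in> carrier L \<and> ext y \<in> carrier L \<and>
    (\<exists>!g. is_glb L g {ext x, ext y}) \<and>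
    is_glb L (ext (\<lambda>r. min (x r) (y r))) {ext x, ext y}"
proof -
  interpret L: partial_order L
    unfolding L_def using assms by (intro partial_order_transversal_extensions)
  have "\<mu> \<in> vm_class E d (stiefel d A)"
    using \<open>matrix_presentation E d \<mu> A\<close> vm_class_refl by (auto simp: matrix_presentation_def)
  then obtain c :: real where c: "\<forall>B\<in>[E]\<^bsup>d\<^esup>. \<mu> B = stiefel d A B + ereal c"
    by (auto simp: vm_class_def)
  have "{B \<in> [E]\<^bsup>d\<^esup>. \<mu> B \<in> range ereal} \<noteq> {}"
    using \<open>valuated_matroid E d \<mu>\<close> unfolding valuated_matroid_def matroid_bases_def
    by (elim conjE)
  \<comment> \<open>A basis of \<open>\<mu>\<close> avoids \<open>star\<close>, so appending any
    column leaves its Stiefel value below \<open>\<infinity>\<close>; it serves as the witness for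
    every \<open>ext z\<close>.\<close>
  then obtain B\<^sub>0 where B\<^sub>0: "B\<^sub>0 \<in> [E]\<^bsup>d\<^esup>" "\<mu> B\<^sub>0 \<noteq> \<infinity>"
    by fastforce
  have in_carrier: "ext z \<in> carrier L" if z: "z \<in> {1..d} \<rightarrow> tropical" for z
  proof -
    have "append_col A star z \<in> {1..d} \<rightarrow> insert star E \<rightarrow> tropical"
      using \<open>A \<in> {1..d} \<rightarrow> E \<rightarrow> tropical\<close> z by (fastforce simp: append_col_def Pi_iff)
    moreover have "B\<^sub>0 \<in> [insert star E]\<^bsup>d\<^esup>"
      using B\<^sub>0(1) by (auto simp: nsets_def)
    moreover have "stiefel d (append_col A star z) B\<^sub>0 \<noteq> \<infinity>"
      using B\<^sub>0 c \<open>star \<notin> E\<close> by (auto simp: stiefel_append_col)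
    ultimately have "valuated_matroid (insert star E) d (stiefel d (append_col A star z))"
      using \<open>finite E\<close> by (intro valuated_matroid_stiefel) auto
    then show ?thesis
      using \<open>matrix_presentation E d \<mu> A\<close> z
      by (auto simp: L_def ext_def transversal_extensions_def transversal_extension_def)
  qed
  \<comment> \<open>The shift by \<open>c\<close> makes every \<open>rep z\<close> agree with
    \<open>\<mu>\<close> on the sets avoiding \<open>star\<close>; between representatives
    normalised in this way the poset order is pointwise.\<close>
  define rep where "rep z B = stiefel d (append_col A star z) B + ereal c" for z B
  have ext_rep: "ext z = vm_class (insert star E) d (rep z)" for z
    unfolding ext_def by (intro vm_class_eq[symmetric]) (auto simp: rep_def vm_class_def)
  have rep_\<mu>: "\<forall>B\<in>[E]\<^bsup>d\<^esup>. rep z B = \<mu> B" for z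
    using c \<open>star \<notin> E\<close> by (simp add: rep_def stiefel_append_col)
  note le_iff = transversal_extensions_le_iff[OF \<open>valuated_matroid E d \<mu>\<close>, where star = star,
      folded L_def]
  let ?m = "\<lambda>r. min (x r) (y r)"
  have rep_min: "rep ?m B = min (rep x B) (rep y B)" if "B \<in> [insert star E]\<^bsup>d\<^esup>" for B
    using that unfolding rep_def
    by (simp add: stiefel_append_col_min nsets_def ereal_min_add)
  have "?m \<in> {1..d} \<rightarrow> tropical"
    using \<open>x \<in> {1..d} \<rightarrow> tropical\<close> \<open>y \<in> {1..d} \<rightarrow> tropical\<close> by (simp add: min_def Pi_iff)
  note carriers = in_carrier[OF \<open>x \<in> {1..d} \<rightarrow> tropical\<close>] in_carrier[OF \<open>y \<in> {1..d} \<rightarrow> tropical\<close>]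
    in_carrier[OF this]
  have glb: "is_glb L (ext ?m) {ext x, ext y}"
  proof (rule greatest_LowerI)
    fix P assume "P \<in> {ext x, ext y}"
    then show "ext ?m \<sqsubseteq>\<^bsub>L\<^esub> P"
      using rep_\<mu> by (auto simp: ext_rep le_iff rep_min)
  next
    fix P assume P: "P \<in> Lower L {ext x, ext y}"
    then have "P \<in> carrier L"
      by (auto simp: Lower_def)
    \<comment> \<open>A competing lower bound may come from a presentation other than
      \<open>A\<close>, but it too can be normalised against \<open>\<mu>\<close> and then compared
      pointwise.\<close>
    then obtain \<nu> where \<nu>: "P = vm_class (insert star E) d \<nu>" "\<forall>B\<in>[E]\<^bsup>d\<^esup>. \<nu> B = \<mu> B"
      using transversal_extensions_representative \<open>star \<notin> E\<close> unfolding L_def by metis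
    have "P \<sqsubseteq>\<^bsub>L\<^esub> ext x" "P \<sqsubseteq>\<^bsub>L\<^esub> ext y"
      using P carriers by (auto simp: Lower_def)
    then show "P \<sqsubseteq>\<^bsub>L\<^esub> ext ?m"
      using \<nu> rep_\<mu> by (simp add: ext_rep le_iff rep_min)
  qed (use carriers in auto)
  moreover have "g = ext ?m" if "is_glb L g {ext x, ext y}" for g
    using L.greatest_unique[OF that glb] .
  ultimately show ?thesis
    using carriers by blast
qed

end
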